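(* Let $\nu$ be a non-negative Borel measure on $[0,2\pi]$ such that $\nu$ is not the sum of two point-masses and $$\int_0^{2\pi}\sin\theta\,d\nu(\theta)=\int_0^{2\pi}\cos\theta\,d\nu(\theta)=0.$$ Then, for every $\phi\in C^1([0,2\pi])$ such that $\phi(0)=\phi(2\pi)$, $$\int_0^{2\pi}\phi(\theta)\,d\nu(\theta)=0\quad\Longrightarrow\quad\int_0^{2\pi}(\phi(\theta))^2\,d\theta\le\int_0^{2\pi}(\phi'(\theta))^2\,d\theta.$$
   Context: A point-mass is a measure concentrated at a single point, i.e. a multiple of a Dirac measure. $C^1([0,2\pi])$ is the space of continuously differentiable real functions on $[0,2\pi]$, and $\phi'$ is the derivative of $\phi$. *)

theory Defs
  imports "HOL-Probability.Probability"
begin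

text \<open>The reference space \<open>M\<close> supplies only the carrier and the sigma-algebra. The weight may be
  \<open>0\<close>, so single point masses and the zero measure are sums of two point masses.\<close>

definition point_mass :: "'a measure \<Rightarrow> 'a measure \<Rightarrow> bool" where
  "point_mass M \<mu> \<longleftrightarrow> (\<exists>a\<in>space M. \<exists>c::real. 0 \<le> c \<and> \<mu> = scale_measure (ennreal c) (return M a))"

definition sum_of_two_point_masses :: "'a measure \<Rightarrow> bool" where
  "sum_of_two_point_masses \<nu> \<longleftrightarrow>
     (\<exists>\<mu>\<^sub>1 \<mu>\<^sub>2. point_mass \<nu> \<mu>\<^sub>1 \<and> point_mass \<nu> \<mu>\<^sub>2 \<and>
        (\<forall>A\<in>sets \<nu>. emeasure \<nu> A = emeasure \<mu>\<^sub>1 A + emeasure \<mu>\<^sub>2 A))"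

end

theory Submission
  imports Defs
begin

text \<open>
  Let \<open>Q f\<close> be the integral of \<open>f'\<^sup>2 - f\<^sup>2\<close> over the circle. Replacing \<open>\<phi>\<close> by \<open>- \<phi>\<close>, we may assume
  that \<open>\<phi>\<close> has nonnegative Lebesgue mean. A first-order wave \<open>l = a cos + b sin\<close> has \<open>\<nu>\<close>-mean zero
  and \<open>\<nu> \<noteq> 0\<close>, so \<open>\<phi> - l + m \<ge> 0\<close> forces \<open>m \<ge> 0\<close>. Take the least \<open>m\<close> for which such an \<open>l\<close> exists.
  By minimality \<open>h = \<phi> - l + m\<close> vanishes somewhere on every closed half circle (otherwise tilt \<open>l\<close>),
  so consecutive zeros of \<open>h\<close> are at most \<open>\<pi>\<close> apart and the Dirichlet inequality gives \<open>Q h \<ge> 0\<close>.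
  Finally \<open>Q \<phi> = Q (h - m) = Q h + 2 m \<integral>\<phi> + 2 \<pi> m\<^sup>2 \<ge> 0\<close>.
\<close>

section \<open>Dirichlet inequality on intervals of length at most pi\<close>

text \<open>
  For \<open>0 < l < 1\<close> the function \<open>F = - l f\<^sup>2 tan (l (x - c))\<close>, with \<open>c\<close> the midpoint, is regular on the
  closed interval, and \<open>f'\<^sup>2 - l\<^sup>2 f\<^sup>2 - F'\<close> is a perfect square; then \<open>l\<close> tends to \<open>1\<close>.
\<close>
lemma dirichlet_interval_nonneg:
  fixes f f' :: "real \<Rightarrow> real"
  assumes "a \<le> b" and len: "b - a \<le> pi" and K: "finite K"
    and cont: "continuous_on {a..b} f"
    and deriv: "\<And>x. x \<in> {a<..<b} - K \<Longrightarrow> (f has_real_derivative f' x) (at x)"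
    and ends: "f a = 0" "f b = 0"
    and int: "(\<lambda>x. (f' x)\<^sup>2 - (f x)\<^sup>2) integrable_on {a..b}"
  shows "0 \<le> integral {a..b} (\<lambda>x. (f' x)\<^sup>2 - (f x)\<^sup>2)"
proof -
  define I where "I = integral {a..b} (\<lambda>x. (f' x)\<^sup>2 - (f x)\<^sup>2)"
  define J where "J = integral {a..b} (\<lambda>x. (f x)\<^sup>2)"
  define c where "c = (a + b) / 2"
  have hI: "((\<lambda>x. (f' x)\<^sup>2 - (f x)\<^sup>2) has_integral I) {a..b}"
    unfolding I_def using int by (rule integrable_integral)
  have hJ: "((\<lambda>x. (f x)\<^sup>2) has_integral J) {a..b}"
    unfolding J_def by (intro integrable_integral integrable_continuous_real continuous_intros cont)
  have main: "0 \<le> I + (1 - l\<^sup>2) * J" if l: "0 < l" "l < 1" for l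
  proof -
    define T where "T x = tan (l * (x - c))" for x
    define F where "F x = - l * (f x)\<^sup>2 * T x" for x
    define D where "D x = - 2 * l * f x * f' x * T x - l\<^sup>2 * (f x)\<^sup>2 * (1 + (T x)\<^sup>2)" for x
    have cospos: "cos (l * (x - c)) > 0" if "x \<in> {a..b}" for x
    proof -
      have "\<bar>x - c\<bar> \<le> pi / 2"
        using that len unfolding c_def by (auto simp: abs_if field_simps)
      then have "\<bar>l * (x - c)\<bar> \<le> l * (pi / 2)"
        using l by (simp add: abs_mult mult_left_mono)
      also have "\<dots> < pi / 2" using l by simp
      finally show ?thesis by (intro cos_gt_zero_pi) auto
    qed
    have "(D has_integral F b - F a) {a..b}"
    \<comment> \<open>\<open>F\<close> may fail to be differentiable on \<open>K\<close>; its
      continuity carries the fundamental theorem across these points. Later \<open>K\<close> holds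
      the junction of a glued periodic function.\<close>
    proof (rule fundamental_theorem_of_calculus_interior_strong[OF K \<open>a \<le> b\<close>])
      show "(F has_vector_derivative D x) (at x)" if "x \<in> {a<..<b} - K" for x
      proof -
        have c0: "cos (l * (x - c)) \<noteq> 0" using cospos[of x] that by auto
        have dT: "(T has_real_derivative l * (1 + (T x)\<^sup>2)) (at x)"
          unfolding T_def
          by (rule derivative_eq_intros refl c0 | simp add: c0 tan_sec)+
             (use c0 tan_sec[OF c0] in \<open>simp add: inverse_eq_divide power_one_over\<close>)
        have "(F has_real_derivative D x) (at x)"
          unfolding F_def D_def
          by (rule derivative_eq_intros dT deriv[OF that] refl)+
             (simp add: algebra_simps power2_eq_square)
        then show ?thesis by (simp add: has_real_derivative_iff_has_vector_derivative)
      qed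
      show "continuous_on {a..b} F"
        unfolding F_def T_def
        by (intro continuous_intros cont) (use cospos in force)
    qed
    then have D0: "(D has_integral 0) {a..b}" by (simp add: F_def ends)
    have "((\<lambda>x. (f' x)\<^sup>2 - (f x)\<^sup>2 + (1 - l\<^sup>2) * (f x)\<^sup>2) has_integral I + (1 - l\<^sup>2) * J) {a..b}"
      by (intro has_integral_add hI has_integral_mult_right hJ)
    moreover have "D x \<le> (f' x)\<^sup>2 - (f x)\<^sup>2 + (1 - l\<^sup>2) * (f x)\<^sup>2" for x
    proof -
      have "(f' x)\<^sup>2 - (f x)\<^sup>2 + (1 - l\<^sup>2) * (f x)\<^sup>2 - D x = (f' x + l * f x * T x)\<^sup>2"
        unfolding D_def by (simp add: algebra_simps power2_eq_square)
      then show ?thesis by (metis diff_ge_0_iff_ge zero_le_power2)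
    qed
    ultimately show ?thesis using has_integral_le[OF D0] by blast
  qed
  have "((\<lambda>l. I + (1 - l\<^sup>2) * J) \<longlongrightarrow> I + (1 - 1\<^sup>2) * J) (at_left 1)"
    by (intro tendsto_intros)
  moreover have "eventually (\<lambda>l::real. 0 \<le> I + (1 - l\<^sup>2) * J) (at_left 1)"
    using eventually_at_left_real[OF zero_less_one] by eventually_elim (rule main, simp_all)
  ultimately have "0 \<le> I + (1 - 1\<^sup>2) * J"
    by (rule tendsto_lowerbound) simp
  then show ?thesis by (simp add: I_def)
qed

section \<open>From intervals to the circle\<close>

text \<open>The window is \<open>{t..T}\<close> followed by the translate of \<open>{0..t}\<close>
  by \<open>T\<close>, so cutting the circle at another point only rearranges two pieces.\<close>

lemma has_integral_periodic_window:
  fixes g :: "real \<Rightarrow> real"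
  assumes g: "(g has_integral I) {0..T}" and t: "0 \<le> t" "t \<le> T"
  shows "((\<lambda>x. if x \<le> T then g x else g (x - T)) has_integral I) {t..t + T}"
proof -
  have "g integrable_on {0..t}" "g integrable_on {t..T}"
    by (rule integrable_subinterval_real[OF has_integral_integrable[OF g]]; use t in auto)+
  then obtain A B where A: "(g has_integral A) {0..t}" and B: "(g has_integral B) {t..T}"
    by (auto simp: integrable_on_def)
  have I: "I = A + B"
    using has_integral_combine[OF t A B] g has_integral_unique by blast
  have "((\<lambda>x. if x \<le> T then g x else g (x - T)) has_integral B) {t..T}"
    by (rule has_integral_eq[OF _ B]) auto
  moreover have "((\<lambda>x. g (x - T)) has_integral A) {T..t + T}"
    using has_integral_affinity[of g A 0 t 1 "- T"] A
    by (simp add: image_affinity_atLeastAtMost t add.commute)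
  \<comment> \<open>At the junction \<open>T\<close> the glued function is \<open>g T\<close> and
    the translate is \<open>g 0\<close>; a single point does not affect the integral.\<close>
  then have "((\<lambda>x. if x \<le> T then g x else g (x - T)) has_integral A) {T..t + T}"
    by (rule has_integral_spike_finite[of "{T}", rotated 2]) auto
  ultimately show ?thesis
    using has_integral_combine[of t T "t + T"] t unfolding I
    by (metis (no_types, lifting) add.commute le_add_same_cancel1)
qed

text \<open>The condition \<open>0 \<le> sin (x - \<beta>)\<close> places \<open>x\<close> in the
  half circle from \<open>\<beta>\<close> to \<open>\<beta> + pi\<close>, modulo
  \<open>2 * pi\<close>. Three arcs between zeros, each of length at most pi, then cover the circle,
  and the Dirichlet inequality applies on each.\<close>

lemma wirtinger_of_half_circle_zeros:
  fixes f f' :: "real \<Rightarrow> real"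
  assumes deriv: "\<And>x. x \<in> {0..2 * pi} \<Longrightarrow> (f has_real_derivative f' x) (at x within {0..2 * pi})"
    and deriv_cont: "continuous_on {0..2 * pi} f'"
    and periodic: "f 0 = f (2 * pi)"
    and zeros: "\<And>\<beta>. \<exists>x\<in>{0..2 * pi}. f x = 0 \<and> 0 \<le> sin (x - \<beta>)"
  shows "0 \<le> integral {0..2 * pi} (\<lambda>x. (f' x)\<^sup>2 - (f x)\<^sup>2)"
proof -
  define F where "F x = (if x \<le> 2 * pi then f x else f (x - 2 * pi))" for x
  define F' where "F' x = (if x \<le> 2 * pi then f' x else f' (x - 2 * pi))" for x
  have cont: "continuous_on {0..2 * pi} f"
    by (rule DERIV_continuous_on) (rule deriv)
  have deriv_at: "(f has_real_derivative f' x) (at x)" if "x \<in> {0<..<2 * pi}" for x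
    using deriv[of x] that by (simp add: at_within_Icc_at)
  have contF: "continuous_on {0..4 * pi} F"
  proof -
    have "continuous_on ({0..2 * pi} \<union> {2 * pi..4 * pi}) F"
      unfolding F_def
    proof (rule continuous_on_If)
      show "continuous_on {2 * pi..4 * pi} (\<lambda>x. f (x - 2 * pi))"
        by (rule continuous_on_compose2[OF cont]) (auto intro!: continuous_intros)
    qed (use cont periodic in \<open>auto dest: antisym\<close>)
    moreover have "{0..2 * pi} \<union> {2 * pi..4 * pi} = {0..4 * pi}" by auto
    ultimately show ?thesis by simp
  qed
  \<comment> \<open>Only the values of \<open>f\<close> are known to match at the ends, not those of
    \<open>f'\<close>, so \<open>F\<close> may have a corner at \<open>2 * pi\<close>.\<close>
  have derivF: "(F has_real_derivative F' x) (at x)" if x: "x \<in> {0<..<4 * pi} - {2 * pi}" for x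
  proof (cases "x < 2 * pi")
    case True
    have "(F has_real_derivative f' x) (at x)"
      by (rule has_field_derivative_transform_within_open[OF deriv_at, of _ "{0<..<2 * pi}"])
         (use True x in \<open>auto simp: F_def\<close>)
    then show ?thesis using True by (simp add: F'_def)
  next
    case False
    have "((\<lambda>x. f (x - 2 * pi)) has_real_derivative f' (x - 2 * pi) * 1) (at x)"
      by (rule DERIV_chain2[OF deriv_at]) (use False x in \<open>auto intro!: derivative_eq_intros\<close>)
    then have "(F has_real_derivative f' (x - 2 * pi) * 1) (at x)"
      by (rule has_field_derivative_transform_within_open[of _ _ _ "{2 * pi<..<4 * pi}"])
         (use False x in \<open>auto simp: F_def\<close>)
    then show ?thesis using False x by (simp add: F'_def)
  qed
  obtain t where t: "t \<in> {0..2 * pi}" "f t = 0" using zeros by blast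
  have Ft: "F t = 0" "F (t + 2 * pi) = 0"
    using t periodic by (auto simp: F_def)
  define I where "I = integral {0..2 * pi} (\<lambda>x. (f' x)\<^sup>2 - (f x)\<^sup>2)"
  have "((\<lambda>x. (f' x)\<^sup>2 - (f x)\<^sup>2) has_integral I) {0..2 * pi}"
    unfolding I_def by (intro integrable_integral integrable_continuous_real continuous_intros cont deriv_cont)
  from has_integral_periodic_window[OF this, of t]
  have int: "((\<lambda>x. (F' x)\<^sup>2 - (F x)\<^sup>2) has_integral I) {t..t + 2 * pi}"
    using t by (simp add: F_def F'_def if_distrib cong: if_cong)
       (smt (verit, best) has_integral_cong)
  \<comment> \<open>The sine condition locates \<open>x\<close> only modulo \<open>2 * pi\<close>.
    Cases 1 and 2 put \<open>x\<close> or its translate in the window; in the other three a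
    translate lies in the open complementary half circle, where the sine is negative.\<close>
  have zero: "\<exists>x\<in>{\<beta>..\<beta> + pi}. F x = 0" if \<beta>: "0 < \<beta>" "\<beta> < 3 * pi" for \<beta>
  proof -
    obtain x where x: "x \<in> {0..2 * pi}" "f x = 0" "0 \<le> sin (x - \<beta>)" using zeros by blast
    have F0: "F x = 0" "F (x + 2 * pi) = 0" using x periodic by (auto simp: F_def)
    consider "x - \<beta> \<in> {0..pi}" | "x + 2 * pi - \<beta> \<in> {0..pi}"
      | "x - \<beta> \<in> {pi<..<2 * pi}" | "x + 2 * pi - \<beta> \<in> {pi<..<2 * pi}"
      | "x + 4 * pi - \<beta> \<in> {pi<..<2 * pi}"
      using x(1) \<beta> by force
    then show ?thesis
    proof cases
      case 1 then show ?thesis using F0 by (intro bexI[of _ x]) auto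
    next
      case 2 then show ?thesis using F0 by (intro bexI[of _ "x + 2 * pi"]) auto
    next
      case 3 then show ?thesis using sin_lt_zero[of "x - \<beta>"] x by auto
    next
      case 4
      then have "sin (x - \<beta> + 2 * pi) < 0" by (intro sin_lt_zero) auto
      then show ?thesis using x by simp
    next
      case 5
      then have "sin (x - \<beta> + 2 * pi + 2 * pi) < 0" by (intro sin_lt_zero) auto
      then show ?thesis using x by (simp only: sin_periodic)
    qed
  qed
  have cZ: "compact {x \<in> {p..q}. F x = 0}" if "0 \<le> p" "q \<le> 4 * pi" for p q
  proof -
    have "continuous_on {p..q} F" by (rule continuous_on_subset[OF contF]) (use that in auto)
    then have "closed {x \<in> {p..q}. F x = 0}" by (intro continuous_closed_preimage_constant) auto
    then have "compact ({p..q} \<inter> {x \<in> {p..q}. F x = 0})" by (intro compact_Int_closed) auto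
    moreover have "{p..q} \<inter> {x \<in> {p..q}. F x = 0} = {x \<in> {p..q}. F x = 0}" by auto
    ultimately show ?thesis by simp
  qed
  \<comment> \<open>\<open>s\<close> is the last zero in the first half of the window and
    \<open>r\<close> the first in the second half; the zeros \<open>t\<close> and
    \<open>t + 2 * pi\<close> make both sets nonempty.\<close>
  obtain s where s: "s \<in> {t..t + pi}" "F s = 0"
    and s_max: "\<And>x. x \<in> {t..t + pi} \<Longrightarrow> F x = 0 \<Longrightarrow> x \<le> s"
    using compact_attains_sup[OF cZ[of t "t + pi"]] t Ft by force
  obtain r where r: "r \<in> {t + pi..t + 2 * pi}" "F r = 0"
    and r_min: "\<And>x. x \<in> {t + pi..t + 2 * pi} \<Longrightarrow> F x = 0 \<Longrightarrow> r \<le> x"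
    using compact_attains_inf[OF cZ[of "t + pi" "t + 2 * pi"]] t Ft by force
  have "r - s \<le> pi"
  proof (rule ccontr)
    assume gap: "\<not> r - s \<le> pi"
    \<comment> \<open>This centres a half circle in the gap, strictly between \<open>s\<close> and
      \<open>r\<close>, where their choice leaves no zeros.\<close>
    define \<beta> where "\<beta> = s + (r - s - pi) / 2"
    have \<beta>: "s < \<beta>" "\<beta> + pi < r" using gap unfolding \<beta>_def by (auto simp: field_simps)
    obtain x where x: "x \<in> {\<beta>..\<beta> + pi}" "F x = 0"
      using zero[of \<beta>] \<beta> s r t by auto
    show False using s_max[of x] r_min[of x] x \<beta> s r by (cases "x \<le> t + pi") auto
  qed
  have nonneg: "0 \<le> integral {p..q} (\<lambda>x. (F' x)\<^sup>2 - (F x)\<^sup>2)"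
    if "p \<le> q" "q - p \<le> pi" "t \<le> p" "q \<le> t + 2 * pi" "F p = 0" "F q = 0" for p q
  proof (rule dirichlet_interval_nonneg[where K = "{2 * pi}"])
    show "continuous_on {p..q} F" by (rule continuous_on_subset[OF contF]) (use that t in auto)
    show "(F has_real_derivative F' x) (at x)" if "x \<in> {p<..<q} - {2 * pi}" for x
      by (rule derivF) (use that \<open>t \<le> p\<close> \<open>q \<le> t + 2 * pi\<close> t in auto)
    show "(\<lambda>x. (F' x)\<^sup>2 - (F x)\<^sup>2) integrable_on {p..q}"
      by (rule integrable_subinterval_real[OF has_integral_integrable[OF int]]) (use that in auto)
  qed (use that in auto)
  let ?q = "\<lambda>x. (F' x)\<^sup>2 - (F x)\<^sup>2"
  have "I = integral {t..t + 2 * pi} ?q" using int by (simp add: integral_unique)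
  also have "\<dots> = integral {t..s} ?q + integral {s..t + 2 * pi} ?q"
    by (rule Henstock_Kurzweil_Integration.integral_combine[symmetric])
       (use s int in auto)
  also have "integral {s..t + 2 * pi} ?q = integral {s..r} ?q + integral {r..t + 2 * pi} ?q"
    by (rule Henstock_Kurzweil_Integration.integral_combine[symmetric])
       (use s r in \<open>auto intro: integrable_subinterval_real[OF has_integral_integrable[OF int]]\<close>)
  finally show ?thesis
    using nonneg[of t s] nonneg[of s r] nonneg[of r "t + 2 * pi"] s r Ft \<open>r - s \<le> pi\<close>
    unfolding I_def by auto
qed

section \<open>Optimal touching wave\<close>

text \<open>Writing the wave as \<open>z \<bullet> cis \<theta>\<close> makes the constraints on
  \<open>(z, m)\<close> closed and linear, so a least \<open>m\<close> exists by compactness. The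
  half circle condition is the first-order optimality condition for \<open>z\<close>.\<close>

lemma extremal_touching_wave:
  fixes \<phi> :: "real \<Rightarrow> real"
  assumes cont: "continuous_on {0..2 * pi} \<phi>"
    and touch: "\<And>z m. \<forall>\<theta>\<in>{0..2 * pi}. z \<bullet> cis \<theta> \<le> \<phi> \<theta> + m \<Longrightarrow> 0 \<le> m"
  shows "\<exists>z m. 0 \<le> m \<and>
    (\<forall>\<beta>. \<exists>\<theta>\<in>{0..2 * pi}. \<phi> \<theta> - z \<bullet> cis \<theta> + m = 0 \<and> 0 \<le> sin (\<theta> - \<beta>))"
proof -
  have ne: "{0..2 * pi} \<noteq> {}" by simp
  obtain u where u: "\<And>\<theta>. \<theta> \<in> {0..2 * pi} \<Longrightarrow> \<phi> \<theta> \<le> \<phi> u"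
    using continuous_attains_sup[OF compact_Icc ne cont] by blast
  obtain v where v: "\<And>\<theta>. \<theta> \<in> {0..2 * pi} \<Longrightarrow> \<phi> v \<le> \<phi> \<theta>"
    using continuous_attains_inf[OF compact_Icc ne cont] by blast
  \<comment> \<open>The cap on \<open>m\<close> is the level reached by the zero wave, so it keeps
    \<open>S\<close> nonempty, loses no minimizer and makes \<open>S\<close> bounded.\<close>
  define S where "S = {(z, m). m \<le> - \<phi> v \<and> (\<forall>\<theta>\<in>{0..2 * pi}. z \<bullet> cis \<theta> \<le> \<phi> \<theta> + m)}"
  have "(0, - \<phi> v) \<in> S" using v by (auto simp: S_def)
  then have "S \<noteq> {}" by blast
  have "S = {p. snd p \<le> - \<phi> v} \<inter> (\<Inter>\<theta>\<in>{0..2 * pi}. {p. fst p \<bullet> cis \<theta> \<le> \<phi> \<theta> + snd p})"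
    by (auto simp: S_def)
  also have "closed \<dots>"
    by (intro closed_Int closed_INT ballI closed_Collect_le continuous_intros)
  finally have "closed S" .
  moreover have "S \<subseteq> cball 0 (\<phi> u - \<phi> v) \<times> {0..- \<phi> v}"
  proof
    fix p assume "p \<in> S"
    then obtain z m where p: "p = (z, m)" "m \<le> - \<phi> v"
      and le: "\<And>\<theta>. \<theta> \<in> {0..2 * pi} \<Longrightarrow> z \<bullet> cis \<theta> \<le> \<phi> \<theta> + m"
      by (auto simp: S_def)
    have "0 \<le> m" by (rule touch[of z]) (use le in auto)
    \<comment> \<open>Testing the constraint at the argument of \<open>z\<close>, where the wave
      attains its amplitude \<open>norm z\<close>, bounds \<open>z\<close>.\<close>
    have "z = of_real (norm z) * cis (Arg2pi z)"
      by (metis Arg2pi_eq cis_conv_exp mult.commute)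
    then have "z \<bullet> cis (Arg2pi z) = norm z * (cis (Arg2pi z) \<bullet> cis (Arg2pi z))"
      by (metis inner_scaleR_left scaleR_conv_of_real)
    also have "\<dots> = norm z" by (simp add: dot_square_norm)
    finally have "norm z \<le> \<phi> (Arg2pi z) + m"
      using le[of "Arg2pi z"] Arg2pi_ge_0[of z] Arg2pi_lt_2pi[of z] by auto
    also have "\<phi> (Arg2pi z) \<le> \<phi> u"
      using u Arg2pi_ge_0[of z] Arg2pi_lt_2pi[of z] by auto
    finally show "p \<in> cball 0 (\<phi> u - \<phi> v) \<times> {0..- \<phi> v}"
      using p \<open>0 \<le> m\<close> by auto
  qed
  then have "bounded S"
    by (rule bounded_subset[rotated]) (intro bounded_Times bounded_cball bounded_closed_interval)
  ultimately have "compact S" by (simp add: compact_eq_bounded_closed)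
  then obtain p where "p \<in> S" and min: "\<And>q. q \<in> S \<Longrightarrow> snd p \<le> snd q"
    using continuous_attains_inf[OF _ \<open>S \<noteq> {}\<close> continuous_on_snd[OF continuous_on_id]] by blast
  obtain z m where p: "p = (z, m)" by (cases p)
  define h where "h \<theta> = \<phi> \<theta> - z \<bullet> cis \<theta> + m" for \<theta>
  have h_nonneg: "0 \<le> h \<theta>" if "\<theta> \<in> {0..2 * pi}" for \<theta>
    using \<open>p \<in> S\<close> that by (auto simp: S_def p h_def algebra_simps)
  have m_le: "m \<le> - \<phi> v" using \<open>p \<in> S\<close> by (auto simp: S_def p)
  have h_cont: "continuous_on {0..2 * pi} h"
    unfolding h_def by (intro continuous_intros cont)
  \<comment> \<open>A wave leaving positive slack everywhere would have a minimal slack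
    \<open>\<eta>\<close>, and \<open>m\<close> could be lowered by it.\<close>
  have not_above: "\<exists>\<theta>\<in>{0..2 * pi}. \<phi> \<theta> - w \<bullet> cis \<theta> + m \<le> 0" for w
  proof (rule ccontr)
    assume neg: "\<not> ?thesis"
    have "continuous_on {0..2 * pi} (\<lambda>\<theta>. \<phi> \<theta> - w \<bullet> cis \<theta> + m)"
      by (intro continuous_intros cont)
    then obtain y where y: "y \<in> {0..2 * pi}"
      "\<And>\<theta>. \<theta> \<in> {0..2 * pi} \<Longrightarrow> \<phi> y - w \<bullet> cis y + m \<le> \<phi> \<theta> - w \<bullet> cis \<theta> + m"
      using continuous_attains_inf[OF compact_Icc ne] by blast
    define \<eta> where "\<eta> = \<phi> y - w \<bullet> cis y + m"
    have "\<eta> > 0" using neg y(1) unfolding \<eta>_def by force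
    have "(w, m - \<eta>) \<in> S"
      using y(2) m_le \<open>\<eta> > 0\<close> by (force simp: S_def \<eta>_def)
    from min[OF this] \<open>\<eta> > 0\<close> p show False by simp
  qed
  have zeros: "\<exists>\<theta>\<in>{0..2 * pi}. h \<theta> = 0 \<and> 0 \<le> sin (\<theta> - \<beta>)" for \<beta>
  proof (rule ccontr)
    assume neg: "\<not> ?thesis"
    define H where "H = {\<theta> \<in> {0..2 * pi}. 0 \<le> sin (\<theta> - \<beta>)}"
    have "compact H"
    proof -
      have "closed {\<theta>. 0 \<le> sin (\<theta> - \<beta>)}" by (intro closed_Collect_le continuous_intros)
      then have "compact ({0..2 * pi} \<inter> {\<theta>. 0 \<le> sin (\<theta> - \<beta>)})" by (intro compact_Int_closed) auto
      moreover have "H = {0..2 * pi} \<inter> {\<theta>. 0 \<le> sin (\<theta> - \<beta>)}" by (auto simp: H_def)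
      ultimately show ?thesis by simp
    qed
    have "\<exists>\<delta>>0. \<forall>\<theta>\<in>H. \<delta> \<le> h \<theta>"
    proof (cases "H = {}")
      case False
      have "continuous_on H h" by (rule continuous_on_subset[OF h_cont]) (auto simp: H_def)
      then obtain y where y: "y \<in> H" "\<And>\<theta>. \<theta> \<in> H \<Longrightarrow> h y \<le> h \<theta>"
        using continuous_attains_inf[OF \<open>compact H\<close> False] by blast
      then have "h y > 0" using neg h_nonneg[of y] by (force simp: H_def)
      then show ?thesis using y by blast
    qed (auto intro: exI[of _ 1])
    then obtain \<delta> where \<delta>: "\<delta> > 0" "\<And>\<theta>. \<theta> \<in> H \<Longrightarrow> \<delta> \<le> h \<theta>" by blast
    \<comment> \<open>The tilt adds \<open>\<delta> / 2 * sin (\<theta> - \<beta>)\<close> to the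
      wave. On \<open>H\<close> this is at most \<open>\<delta> / 2\<close>, below \<open>h\<close>;
      off \<open>H\<close> it is negative while \<open>h\<close> is nonnegative. So the tilted wave
      leaves positive slack everywhere.\<close>
    obtain \<theta> where \<theta>: "\<theta> \<in> {0..2 * pi}" "\<phi> \<theta> - (z + (\<delta> / 2) *\<^sub>R cis (\<beta> + pi / 2)) \<bullet> cis \<theta> + m \<le> 0"
      using not_above by blast
    have "cis (\<beta> + pi / 2) \<bullet> cis \<theta> = sin (\<theta> - \<beta>)"
      by (simp add: inner_complex_def cos_add sin_add sin_diff)
    then have le: "h \<theta> \<le> \<delta> / 2 * sin (\<theta> - \<beta>)"
      using \<theta>(2) by (simp add: h_def inner_add_left)
    show False
    proof (cases "\<theta> \<in> H")
      case True
      have "\<delta> / 2 * sin (\<theta> - \<beta>) \<le> \<delta> / 2 * 1" using \<delta>(1) by (intro mult_left_mono) auto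
      then show False using \<delta>(2)[OF True] \<delta>(1) le by linarith
    next
      case False
      then have "sin (\<theta> - \<beta>) < 0" using \<theta>(1) by (auto simp: H_def)
      then have "\<delta> / 2 * sin (\<theta> - \<beta>) < 0" using \<delta>(1) by (simp add: mult_pos_neg)
      then show False using le h_nonneg[OF \<theta>(1)] by simp
    qed
  qed
  have "0 \<le> m"
  proof (rule touch, rule ballI)
    show "z \<bullet> cis \<theta> \<le> \<phi> \<theta> + m" if "\<theta> \<in> {0..2 * pi}" for \<theta>
      using h_nonneg[OF that] by (simp add: h_def)
  qed
  then show ?thesis using zeros unfolding h_def by blast
qed

section \<open>Removing the wave and the constant\<close>

text \<open>Since \<open>l'' = - l\<close>, the wave lies in the radical of the quadratic form on
  periodic functions, so subtracting it costs nothing. The remaining constant contributes only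
  nonnegative terms because \<open>m\<close> and the mean are nonnegative.\<close>

lemma wirtinger_of_touching:
  fixes \<phi> \<phi>' :: "real \<Rightarrow> real"
  assumes deriv: "\<And>\<theta>. \<theta> \<in> {0..2 * pi} \<Longrightarrow>
                    (\<phi> has_real_derivative \<phi>' \<theta>) (at \<theta> within {0..2 * pi})"
    and deriv_cont: "continuous_on {0..2 * pi} \<phi>'"
    and periodic: "\<phi> 0 = \<phi> (2 * pi)"
    and touch: "\<And>z m. \<forall>\<theta>\<in>{0..2 * pi}. z \<bullet> cis \<theta> \<le> \<phi> \<theta> + m \<Longrightarrow> 0 \<le> m"
    and mean: "0 \<le> integral {0..2 * pi} \<phi>"
  shows "integral {0..2 * pi} (\<lambda>\<theta>. (\<phi> \<theta>)\<^sup>2) \<le> integral {0..2 * pi} (\<lambda>\<theta>. (\<phi>' \<theta>)\<^sup>2)"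
proof -
  have cont: "continuous_on {0..2 * pi} \<phi>"
    by (rule DERIV_continuous_on) (rule deriv)
  have "\<exists>z m. 0 \<le> m \<and>
    (\<forall>\<beta>. \<exists>\<theta>\<in>{0..2 * pi}. \<phi> \<theta> - z \<bullet> cis \<theta> + m = 0 \<and> 0 \<le> sin (\<theta> - \<beta>))"
    by (rule extremal_touching_wave[OF cont]) (rule touch)
  then obtain z m where m: "0 \<le> m"
    and zeros: "\<And>\<beta>. \<exists>\<theta>\<in>{0..2 * pi}. \<phi> \<theta> - z \<bullet> cis \<theta> + m = 0 \<and> 0 \<le> sin (\<theta> - \<beta>)"
    by blast
  define l where "l \<theta> = Re z * cos \<theta> + Im z * sin \<theta>" for \<theta>
  define l' where "l' \<theta> = Im z * cos \<theta> - Re z * sin \<theta>" for \<theta>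
  define h where "h \<theta> = \<phi> \<theta> - l \<theta> + m" for \<theta>
  define h' where "h' \<theta> = \<phi>' \<theta> - l' \<theta>" for \<theta>
  have dl: "(l has_real_derivative l' x) (at x within {0..2 * pi})"
    and dl': "(l' has_real_derivative - l x) (at x within {0..2 * pi})" for x
    unfolding l_def l'_def by (auto intro!: derivative_eq_intros)
  have cl: "continuous_on {0..2 * pi} l" "continuous_on {0..2 * pi} l'"
    unfolding l_def l'_def by (intro continuous_intros)+
  have dh: "(h has_real_derivative h' x) (at x within {0..2 * pi})" if "x \<in> {0..2 * pi}" for x
    unfolding h_def h'_def by (rule derivative_eq_intros deriv[OF that] dl refl)+ simp
  have ch: "continuous_on {0..2 * pi} h" "continuous_on {0..2 * pi} h'"
    unfolding h_def h'_def by (intro continuous_intros cont deriv_cont cl)+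
  have ph: "h 0 = h (2 * pi)" using periodic by (simp add: h_def l_def)
  \<comment> \<open>\<open>E\<close> is a primitive of all terms involving \<open>l\<close> in the
    expansion of the form at \<open>h + l\<close>; it is periodic, so these terms integrate to
    zero.\<close>
  define E where "E x = 2 * h x * l' x + l x * l' x" for x
  define E' where "E' x = 2 * h' x * l' x - 2 * h x * l x + (l' x)\<^sup>2 - (l x)\<^sup>2" for x
  have "(E' has_integral E (2 * pi) - E 0) {0..2 * pi}"
  proof (rule fundamental_theorem_of_calculus)
    fix x assume x: "x \<in> {0..2 * pi}"
    have "(E has_real_derivative E' x) (at x within {0..2 * pi})"
      unfolding E_def E'_def
      by (rule derivative_eq_intros dh[OF x] dl dl' refl)+ (simp add: algebra_simps power2_eq_square)
    then show "(E has_vector_derivative E' x) (at x within {0..2 * pi})"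
      by (simp add: has_real_derivative_iff_has_vector_derivative)
  qed simp
  then have E: "(E' has_integral 0) {0..2 * pi}" using ph by (simp add: E_def l_def l'_def)
  define Q where "Q = integral {0..2 * pi} (\<lambda>x. (h' x)\<^sup>2 - (h x)\<^sup>2)"
  have Q: "((\<lambda>x. (h' x)\<^sup>2 - (h x)\<^sup>2) has_integral Q) {0..2 * pi}"
    unfolding Q_def by (intro integrable_integral integrable_continuous_real continuous_intros ch)
  have "0 \<le> Q"
    unfolding Q_def
    by (rule wirtinger_of_half_circle_zeros[OF dh ch(2) ph])
       (use zeros in \<open>auto simp: h_def l_def inner_complex_def\<close>)
  have \<phi>: "(\<phi> has_integral integral {0..2 * pi} \<phi>) {0..2 * pi}"
    by (intro integrable_integral integrable_continuous_real cont)
  have const: "((\<lambda>x. m\<^sup>2) has_integral 2 * pi * m\<^sup>2) {0..2 * pi}"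
    using has_integral_const_real[of "m\<^sup>2" 0 "2 * pi"] by simp
  have "((\<lambda>x. ((h' x)\<^sup>2 - (h x)\<^sup>2) + 2 * m * \<phi> x + m\<^sup>2 + E' x) has_integral
      Q + 2 * m * integral {0..2 * pi} \<phi> + 2 * pi * m\<^sup>2 + 0) {0..2 * pi}"
    by (rule has_integral_add[OF has_integral_add[OF has_integral_add[OF Q
          has_integral_mult_right[OF \<phi>]] const] E])
  \<comment> \<open>Expand with \<open>\<phi> = h + l - m\<close>. The mixed term
    \<open>2 * m * (h + l)\<close> equals \<open>2 * m * \<phi> + 2 * m\<^sup>2\<close>, which turns
    \<open>- m\<^sup>2\<close> into \<open>+ m\<^sup>2\<close>.\<close>
  moreover have "((h' x)\<^sup>2 - (h x)\<^sup>2) + 2 * m * \<phi> x + m\<^sup>2 + E' x = (\<phi>' x)\<^sup>2 - (\<phi> x)\<^sup>2" for x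
    unfolding E'_def h_def h'_def by (simp add: algebra_simps power2_eq_square)
  ultimately have "integral {0..2 * pi} (\<lambda>x. (\<phi>' x)\<^sup>2 - (\<phi> x)\<^sup>2) =
      Q + 2 * m * integral {0..2 * pi} \<phi> + 2 * pi * m\<^sup>2"
    by (simp add: integral_unique)
  also have "\<dots> \<ge> 0" using \<open>0 \<le> Q\<close> m mean by simp
  finally have "0 \<le> integral {0..2 * pi} (\<lambda>x. (\<phi>' x)\<^sup>2 - (\<phi> x)\<^sup>2)" .
  also have "\<dots> = integral {0..2 * pi} (\<lambda>\<theta>. (\<phi>' \<theta>)\<^sup>2) - integral {0..2 * pi} (\<lambda>\<theta>. (\<phi> \<theta>)\<^sup>2)"
    by (intro Henstock_Kurzweil_Integration.integral_diff integrable_continuous_real continuous_intros cont deriv_cont)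
  finally show ?thesis by simp
qed

section \<open>Information from the measure\<close>

text \<open>Two point masses of weight 0 give the zero measure; by contraposition the measure in the
  theorem has nonzero mass.\<close>

lemma sum_of_two_point_masses_null:
  assumes "space \<nu> \<noteq> {}" and "emeasure \<nu> (space \<nu>) = 0"
  shows "sum_of_two_point_masses \<nu>"
proof -
  obtain a where a: "a \<in> space \<nu>" using assms(1) by blast
  have "point_mass \<nu> (scale_measure 0 (return \<nu> a))"
    unfolding point_mass_def using a by (intro bexI[of _ a] exI[of _ 0]) auto
  moreover have "emeasure \<nu> A = 0" for A
    using assms(2) by (metis emeasure_eq_0 emeasure_notin_sets sets.sets_into_space sets.top)
  ultimately show ?thesis
    unfolding sum_of_two_point_masses_def by (intro exI conjI) auto
qed

text \<open>Subtracting the wave from \<phi> leaves the \<nu>-integral zero. If \<open>m\<close>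
  were negative the difference would be strictly positive, which forces \<nu> to vanish.\<close>

lemma balanced_measure_touching:
  fixes \<nu> :: "real measure" and \<phi> :: "real \<Rightarrow> real"
  assumes borel: "sets \<nu> = sets (restrict_space borel {0..2 * pi})"
    and nonzero: "emeasure \<nu> (space \<nu>) \<noteq> 0"
    and sin_moment: "has_bochner_integral \<nu> sin 0"
    and cos_moment: "has_bochner_integral \<nu> cos 0"
    and cont: "continuous_on {0..2 * pi} \<phi>"
    and mean_zero: "(\<integral>\<theta>. \<phi> \<theta> \<partial>\<nu>) = 0"
    and below: "\<forall>\<theta>\<in>{0..2 * pi}. z \<bullet> cis \<theta> \<le> \<phi> \<theta> + m"
  shows "0 \<le> m"
proof -
  have space: "space \<nu> = {0..2 * pi}"
    using sets_eq_imp_space_eq[OF borel] by (simp add: space_restrict_space)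
  have isin: "integrable \<nu> sin" "(\<integral>\<theta>. sin \<theta> \<partial>\<nu>) = 0"
    and icos: "integrable \<nu> cos" "(\<integral>\<theta>. cos \<theta> \<partial>\<nu>) = 0"
    using sin_moment cos_moment by (auto simp: has_bochner_integral_iff)
  \<comment> \<open>Finiteness of \<nu> comes from the moments: the integrable function
    \<open>\<bar>sin \<theta>\<bar> + \<bar>cos \<theta>\<bar>\<close> is at least 1.\<close>
  have "integrable \<nu> (\<lambda>_. 1::real)"
  proof (rule Bochner_Integration.integrable_bound)
    show "integrable \<nu> (\<lambda>\<theta>. \<bar>sin \<theta>\<bar> + \<bar>cos \<theta>\<bar>)"
      using isin icos by auto
    have "1 \<le> \<bar>sin \<theta>\<bar> + \<bar>cos \<theta>\<bar>" for \<theta> :: real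
    proof -
      have "1\<^sup>2 \<le> (\<bar>sin \<theta>\<bar> + \<bar>cos \<theta>\<bar>)\<^sup>2" by (simp add: power2_sum)
      then show ?thesis by (rule power2_le_imp_le) simp
    qed
    then show "AE \<theta> in \<nu>. norm (1::real) \<le> norm (\<bar>sin \<theta>\<bar> + \<bar>cos \<theta>\<bar>)" by simp
  qed simp
  then have fin: "finite_measure \<nu>"
    by (intro finite_measureI) (auto simp: integrable_iff_bounded)
  interpret finite_measure \<nu> by (rule fin)
  have "\<phi> \<in> borel_measurable (restrict_space borel {0..2 * pi})"
    by (rule borel_measurable_continuous_on_restrict[OF cont])
  then have meas: "\<phi> \<in> borel_measurable \<nu>" using measurable_cong_sets[OF borel refl] by blast
  obtain B where B: "\<And>\<theta>. \<theta> \<in> {0..2 * pi} \<Longrightarrow> norm (\<phi> \<theta>) \<le> B"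
    using compact_imp_bounded[OF compact_continuous_image[OF cont compact_Icc]]
    unfolding bounded_iff by blast
  \<comment> \<open>Integrability ensures that \<open>mean_zero\<close> is a genuine value and not
    the default 0 of the Bochner integral.\<close>
  have int: "integrable \<nu> \<phi>"
    by (rule integrable_const_bound[of _ B]) (use B meas space in auto)
  show "0 \<le> m"
  proof (rule ccontr)
    assume "\<not> 0 \<le> m"
    define g where "g \<theta> = \<phi> \<theta> - Re z * cos \<theta> - Im z * sin \<theta>" for \<theta>
    have pos: "0 < g \<theta>" if "\<theta> \<in> space \<nu>" for \<theta>
      using bspec[OF below, of \<theta>] that \<open>\<not> 0 \<le> m\<close> by (simp add: g_def space inner_complex_def)
    have ig: "integrable \<nu> g" unfolding g_def using int isin icos by auto
    have "(\<integral>\<theta>. g \<theta> \<partial>\<nu>) = 0"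
      unfolding g_def using int isin icos mean_zero by simp
    then have "AE \<theta> in \<nu>. g \<theta> = 0"
      using integral_nonneg_eq_0_iff_AE[OF ig] pos by (simp add: less_imp_le)
    then have "AE \<theta> in \<nu>. False"
      using AE_space by eventually_elim (use pos in force)
    then have "emeasure \<nu> (space \<nu>) = 0"
      by (simp add: AE_iff_measurable[OF sets.top])
    then show False using nonzero by simp
  qed
qed

theorem corollary1:
  fixes \<nu> :: "real measure" and \<phi> \<phi>' :: "real \<Rightarrow> real"
  assumes borel: "sets \<nu> = sets (restrict_space borel {0..2 * pi})"
    and not_two_point_masses: "\<not> sum_of_two_point_masses \<nu>"
    and sin_moment: "has_bochner_integral \<nu> sin 0"
    and cos_moment: "has_bochner_integral \<nu> cos 0"
    and deriv: "\<And>\<theta>. \<theta> \<in> {0..2 * pi} \<Longrightarrow>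
                  (\<phi> has_real_derivative \<phi>' \<theta>) (at \<theta> within {0..2 * pi})"
    and deriv_cont: "continuous_on {0..2 * pi} \<phi>'"
    and periodic: "\<phi> 0 = \<phi> (2 * pi)"
    and mean_zero: "(\<integral>\<theta>. \<phi> \<theta> \<partial>\<nu>) = 0"
  shows "integral {0..2 * pi} (\<lambda>\<theta>. (\<phi> \<theta>)\<^sup>2) \<le> integral {0..2 * pi} (\<lambda>\<theta>. (\<phi>' \<theta>)\<^sup>2)"
proof -
  have "space \<nu> \<noteq> {}"
    using sets_eq_imp_space_eq[OF borel] by (simp add: space_restrict_space)
  then have nonzero: "emeasure \<nu> (space \<nu>) \<noteq> 0"
    using not_two_point_masses sum_of_two_point_masses_null[of \<nu>] by argo
  have cont: "continuous_on {0..2 * pi} \<phi>"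
    by (rule DERIV_continuous_on) (rule deriv)
  note touch = balanced_measure_touching[OF borel nonzero sin_moment cos_moment]
  show ?thesis
  proof (cases "0 \<le> integral {0..2 * pi} \<phi>")
    case True
    show ?thesis
      by (rule wirtinger_of_touching[OF deriv deriv_cont periodic touch[OF cont mean_zero] True])
  next
    case False
    \<comment> \<open>The \<nu>-mean stays zero under the sign change, so the touching bound holds
      for \<open>- \<phi>\<close> as well, while the Lebesgue mean becomes positive.\<close>
    have "integral {0..2 * pi} (\<lambda>\<theta>. (- \<phi> \<theta>)\<^sup>2) \<le> integral {0..2 * pi} (\<lambda>\<theta>. (- \<phi>' \<theta>)\<^sup>2)"
    proof (rule wirtinger_of_touching)
      show "0 \<le> m" if below: "\<forall>\<theta>\<in>{0..2 * pi}. z \<bullet> cis \<theta> \<le> - \<phi> \<theta> + m" for z m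
        by (rule touch[OF continuous_on_minus[OF cont] _ below]) (simp add: mean_zero)
      show "((\<lambda>\<theta>. - \<phi> \<theta>) has_real_derivative - \<phi>' \<theta>) (at \<theta> within {0..2 * pi})"
        if "\<theta> \<in> {0..2 * pi}" for \<theta>
        by (rule DERIV_minus[OF deriv[OF that]])
    qed (use False periodic continuous_on_minus[OF deriv_cont] in simp_all)
    then show ?thesis by simp
  qed
qed

end
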